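(* Let $\phi\in L^2(\mathbb{R})\setminus\{0\}$ be a window function and $f\in L^2(\mathbb{R})$. Let $D,S$ be measurable sets in $\mathbb{R}$ such that $\operatorname{supp}(f)\subseteq D$ and $\operatorname{supp}\bigl(V_{\phi}^{A}f(\cdot,w)\bigr)\subseteq S$ for every $w\in\mathbb{R}$. If $|D|\,|S|<+\infty$, then $f=0$.
   Context: Let $A=(a,b,c,d,u_{0},w_{0})$ with $a,b,c,d,u_0,w_0\in\mathbb{R}$, $ad-bc=1$ and $b\neq 0$. The offset linear canonical transform kernel is $$K_{A}(t,u)=\frac{1}{\sqrt{i2\pi b}}\,e^{i\frac{a}{2b}t^{2}-i\frac{1}{b}t(u-u_{0})-i\frac{1}{b}u(du_{0}-bw_{0})+i\frac{d}{2b}(u^{2}+u_{0}^{2})}.$$ For a window function $\phi\in L^2(\mathbb{R})\setminus\{0\}$, the windowed offset linear canonical transform (WOLCT) of $f\in L^2(\mathbb{R})$ is $$V^{A}_{\phi}f(u,w)=\int_{\mathbb{R}}f(t)\,\overline{\phi(t-w)}\,K_{A}(t,u)\,dt,\qquad (u,w)\in\mathbb{R}^2 .$$ $|D|$ and $|S|$ denote Lebesgue measures. *)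

theory Defs
  imports "HOL-Analysis.Analysis"
begin

(* Elements of L^2(R) are represented by functions; "f = 0" in L^2(R) is therefore
   "f t = 0 for almost every t". *)
definition L2_real :: "(real \<Rightarrow> complex) set" where
  "L2_real = {f. f \<in> borel_measurable lebesgue \<and> integrable lebesgue (\<lambda>t. (norm (f t))\<^sup>2)}"

(* Inclusion supp f \<subseteq> D for a function known only up to null sets. It is implied by the inclusion
   in D of the set {t. f t \<noteq> 0}, of its closure, or of the essential support (the complement of the
   largest open set on which f = 0 a.e.), so as a hypothesis it covers each of these readings. *)
definition supp_subset :: "(real \<Rightarrow> complex) \<Rightarrow> real set \<Rightarrow> bool" where
  "supp_subset f D \<longleftrightarrow> (AE t in lebesgue. t \<in> support_on UNIV f \<longrightarrow> t \<in> D)"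

type_synonym olct_params = "real \<times> real \<times> real \<times> real \<times> real \<times> real"

(* The parameter tuple is (a, b, c, d, u0, w0); csqrt is the principal branch, which fixes the
   square root of 2 pi i b for either sign of b. *)
fun olct_kernel :: "olct_params \<Rightarrow> real \<Rightarrow> real \<Rightarrow> complex" where
  "olct_kernel (a, b, c, d, u0, w0) t u =
     1 / csqrt (\<i> * 2 * of_real pi * of_real b) *
     exp (\<i> * of_real (a / (2 * b) * t\<^sup>2)
          - \<i> * of_real (1 / b * t * (u - u0))
          - \<i> * of_real (1 / b * u * (d * u0 - b * w0))
          + \<i> * of_real (d / (2 * b) * (u\<^sup>2 + u0\<^sup>2)))"

definition wolct ::
  "olct_params \<Rightarrow> (real \<Rightarrow> complex) \<Rightarrow> (real \<Rightarrow> complex) \<Rightarrow> real \<Rightarrow> real \<Rightarrow> complex" where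
  "wolct A \<phi> f u w = (\<integral>t. f t * cnj (\<phi> (t - w)) * olct_kernel A t u \<partial>lebesgue)"

end

theory Submission
  imports Defs "HOL-Probability.Levy"
begin

text \<open>
  The claim reduces to Benedicks' theorem: an integrable function on the line that is nonzero only on
  a set of finite measure, and whose Fourier transform is nonzero only on a set of finite measure,
  vanishes almost everywhere.

  For fixed \<open>w\<close>, the windowed transform of \<open>f\<close> in the variable \<open>u\<close> is, up to a nowhere vanishing
  factor and the rescaling \<open>x = - u / b\<close>, the Fourier transform of the integrable function \<open>g\<close> that
  arises from \<open>f t * cnj (\<phi> (t - w))\<close> by multiplication with a unimodular chirp
  (\<open>wolct_eq_fourier\<close>). So \<open>g\<close> lives on \<open>D\<close> and its Fourier transform on a rescaling of \<open>S\<close>. If both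
  have finite measure, Benedicks' theorem gives \<open>g = 0\<close>; if \<open>S\<close> is null, the continuous Fourier
  transform of \<open>g\<close> vanishes identically and \<open>g = 0\<close> by uniqueness; if \<open>D\<close> is null there is nothing to
  show. Thus \<open>f t * cnj (\<phi> (t - w)) = 0\<close> for almost every \<open>t\<close>, for every \<open>w\<close>. As \<open>\<phi>\<close> is not zero,
  Tonelli's theorem yields \<open>f = 0\<close> (\<open>AE_mult_translates_eq_0\<close>).

  Benedicks' theorem rests on periodization. Take a period \<open>T = 2 * pi / w\<close> longer than the measure of
  \<open>g \<noteq> 0\<close>. For almost every \<open>x\<close>, the lattice \<open>x + w * n\<close> meets the nonzero set of the transform in
  finitely many points (\<open>AE_finite_lattice_points\<close>), so the periodization of \<open>g t * cis (x * t)\<close> with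
  period \<open>T\<close> is a trigonometric polynomial. It vanishes on a set of positive measure, because
  \<open>g \<noteq> 0\<close> is too small to cover a whole period, and is therefore zero; in particular so is its
  coefficient, the transform at \<open>x\<close> (\<open>fourier_lattice_eq_0\<close>). Uniqueness for the Fourier transform
  comes from Levy's theorem on characteristic functions, uniqueness for Fourier coefficients from
  the Stone--Weierstrass theorem on the circle.
\<close>

section \<open>The Fourier transform of an integrable function\<close>

definition fourier :: "(real \<Rightarrow> complex) \<Rightarrow> real \<Rightarrow> complex" where
  "fourier g x = (\<integral>t. g t * cis (x * t) \<partial>lborel)"

lemma borel_measurable_cis [measurable]: "cis \<in> borel_measurable borel"
  by (intro borel_measurable_continuous_onI continuous_intros)

lemma borel_measurable_cnj [measurable]: "cnj \<in> borel_measurable borel"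
  by (intro borel_measurable_continuous_onI continuous_intros)

lemma integrable_mult_bounded:
  fixes f g :: "'a \<Rightarrow> complex"
  assumes "integrable M f" "g \<in> borel_measurable M" "\<And>x. norm (g x) \<le> C"
  shows "integrable M (\<lambda>x. f x * g x)"
proof (rule Bochner_Integration.integrable_bound)
  show "integrable M (\<lambda>x. C * norm (f x))"
    using assms(1) by auto
  show "(\<lambda>x. f x * g x) \<in> borel_measurable M"
    using assms by auto
  have "norm (f x) * norm (g x) \<le> norm (f x) * C" for x
    using assms(3) by (intro mult_left_mono) auto
  moreover have "0 \<le> C" using assms(3) norm_ge_zero order_trans by blast
  ultimately show "AE x in M. norm (f x * g x) \<le> norm (C * norm (f x))"
    by (auto simp: norm_mult mult.commute)
qed

lemma integrable_mult_cis:
  assumes "integrable lborel g"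
  shows "integrable lborel (\<lambda>t. g t * cis (x * t))"
  using assms by (rule integrable_mult_bounded[where C = 1]) auto

text \<open>
  Continuity turns statements about almost every frequency into statements about every frequency,
  and makes the set of frequencies where the transform is nonzero open, hence Borel.
\<close>
lemma continuous_on_fourier:
  assumes g: "integrable lborel g"
  shows "continuous_on UNIV (fourier g)"
proof -
  note [measurable] = borel_measurable_integrable[OF g]
  have "(\<lambda>n. fourier g (X n)) \<longlonglongrightarrow> fourier g x" if "X \<longlonglongrightarrow> x" for X x
    unfolding fourier_def
  proof (rule integral_dominated_convergence[where w = "\<lambda>t. norm (g t)"])
    have "(\<lambda>n. g t * cis (X n * t)) \<longlonglongrightarrow> g t * cis (x * t)" for t
      by (intro tendsto_intros that)
    then show "AE t in lborel. (\<lambda>n. g t * cis (X n * t)) \<longlonglongrightarrow> g t * cis (x * t)"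
      by simp
  qed (use g in \<open>auto simp: norm_mult\<close>)
  then show ?thesis
    by (auto simp: continuous_on_sequentially o_def)
qed

lemma borel_measurable_fourier:
  assumes "integrable lborel g"
  shows "fourier g \<in> borel_measurable borel"
  using continuous_on_fourier[OF assms] by (rule borel_measurable_continuous_onI)

text \<open>
  With the positive sign in the exponent, the transform of a nonnegative function is the
  characteristic function of the measure with that density. This makes Levy's uniqueness theorem
  applicable to integrable functions.
\<close>
lemma fourier_eq_char:
  fixes p :: "real \<Rightarrow> real"
  assumes [measurable]: "p \<in> borel_measurable borel" and "\<And>t. 0 \<le> p t"
  shows "fourier (\<lambda>t. of_real (p t)) x = char (density lborel (\<lambda>t. ennreal (p t))) x"
  unfolding fourier_def char_def
  by (subst integral_density) (use assms in \<open>auto simp: scaleR_conv_of_real cis_conv_exp mult.commute\<close>)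

lemma real_distribution_density:
  assumes [measurable]: "p \<in> borel_measurable borel" and int: "integrable lborel p" 
    and nn: "\<And>t. 0 \<le> p t" and one: "(\<integral>t. p t \<partial>lborel) = 1"
  shows "real_distribution (density lborel (\<lambda>t. ennreal (p t)))"
proof -
  have "emeasure (density lborel (\<lambda>t. ennreal (p t))) UNIV = 1"
    using nn_integral_eq_integral[OF int] nn one by (simp add: emeasure_density)
  then show ?thesis
    by (intro real_distribution.intro prob_spaceI) (auto simp: real_distribution_axioms_def)
qed

text \<open>
  The positive and the negative part of \<open>h\<close> have the same transform; at frequency 0 this says that
  they have the same total mass \<open>m\<close>. If \<open>m > 0\<close>, dividing by \<open>m\<close> gives two probability densities
  with equal characteristic functions, so the two parts agree almost everywhere.
\<close>
lemma fourier_of_real_eq_0: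
  fixes h :: "real \<Rightarrow> real"
  assumes h: "integrable lborel h" and F: "\<And>x. fourier (\<lambda>t. of_real (h t)) x = 0"
  shows "AE t in lborel. h t = 0"
proof -
  note [measurable] = borel_measurable_integrable[OF h]
  define p where "p t = max 0 (h t)" for t
  define q where "q t = max 0 (- h t)" for t
  define m where "m = (\<integral>t. p t \<partial>lborel)"
  have [measurable]: "p \<in> borel_measurable borel" "q \<in> borel_measurable borel"
    using borel_measurable_integrable[OF h] unfolding p_def[abs_def] q_def[abs_def] by measurable
  have ip: "integrable lborel p" and iq: "integrable lborel q"
    using h unfolding p_def[abs_def] q_def[abs_def] by auto
  have pq: "h t = p t - q t" for t by (auto simp: p_def q_def)
  have ic: "integrable lborel (\<lambda>t. of_real (p t) * cis (x * t))"
     "integrable lborel (\<lambda>t. of_real (q t) * cis (x * t))" for x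
    using ip iq by (auto intro!: integrable_mult_cis)
  have eq: "fourier (\<lambda>t. of_real (p t)) x = fourier (\<lambda>t. of_real (q t)) x" for x
    using F[of x] Bochner_Integration.integral_diff[OF ic[of x]]
    unfolding fourier_def pq by (simp add: left_diff_distrib)
  have mq: "(\<integral>t. q t \<partial>lborel) = m"
    using eq[of 0] by (simp add: fourier_def m_def)
  have nn: "0 \<le> p t" "0 \<le> q t" for t by (auto simp: p_def q_def)
  have "0 \<le> m" unfolding m_def using nn by simp
  show ?thesis
  proof (cases "m = 0")
    case True
    have "AE t in lborel. p t = 0" "AE t in lborel. q t = 0"
      using True mq ip iq nn integral_nonneg_eq_0_iff_AE[of lborel p]
        integral_nonneg_eq_0_iff_AE[of lborel q] by (auto simp: m_def)
    then show ?thesis unfolding pq by eventually_elim simp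
  next
    case False
    with \<open>0 \<le> m\<close> have m: "m > 0" by simp
    let ?M = "\<lambda>p. density lborel (\<lambda>t. ennreal (p t / m))"
    have "char (?M p) = char (?M q)"
    proof
      fix x
      have "fourier (\<lambda>t. of_real (p t / m)) x = fourier (\<lambda>t. of_real (q t / m)) x"
        using eq[of x] by (simp add: fourier_def)
      then show "char (?M p) x = char (?M q) x"
        using fourier_eq_char[of "\<lambda>t. p t / m" x] fourier_eq_char[of "\<lambda>t. q t / m" x] nn m by simp
    qed
    moreover have "real_distribution (?M p)" "real_distribution (?M q)"
      using ip iq nn m mq by (auto intro!: real_distribution_density simp: m_def)
    ultimately have "?M p = ?M q"
      by (intro Levy_uniqueness) auto
    then have "AE t in lborel. ennreal (p t / m) = ennreal (q t / m)"
      by (subst (asm) sigma_finite_measure.density_unique_iff[OF sigma_finite_lborel]) auto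
    then show ?thesis
      by eventually_elim (use nn m pq in \<open>auto simp: \<close>)
  qed
qed

text \<open>
  Conjugating \<open>g\<close> conjugates and reflects its transform. Hence the transforms of the real and the
  imaginary part of \<open>g\<close> vanish too, and the real case applies to each.
\<close>
lemma fourier_eq_0_imp_AE_eq_0:
  assumes g: "integrable lborel g" and F: "\<And>x. fourier g x = 0"
  shows "AE t in lborel. g t = 0"
proof -
  have cnj: "fourier (\<lambda>t. cnj (g t)) x = 0" for x
  proof -
    have "fourier (\<lambda>t. cnj (g t)) x = cnj (fourier g (- x))"
      unfolding fourier_def by (subst Bochner_Integration.integral_cnj[symmetric]) (simp add: cis_cnj)
    then show ?thesis by (simp add: F)
  qed
  have ic: "integrable lborel (\<lambda>t. cnj (g t))" using g by simp
  have "fourier (\<lambda>t. of_real (Re (g t))) x = (fourier g x + fourier (\<lambda>t. cnj (g t)) x) / 2" for x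
    unfolding fourier_def
    by (subst Bochner_Integration.integral_add[symmetric])
       (use g ic in \<open>auto intro!: integrable_mult_cis simp: complex_add_cnj ring_distribs(2)[symmetric]
          simp flip: integral_divide_zero\<close>)
  moreover have "fourier (\<lambda>t. of_real (Im (g t))) x
      = (fourier g x - fourier (\<lambda>t. cnj (g t)) x) / (2 * \<i>)" for x
  proof -
    have Im: "of_real (Im z) = (z - cnj z) / (2 * \<i>)" for z
      by (simp add: complex_eq_iff)
    have "fourier (\<lambda>t. of_real (Im (g t))) x
        = (\<integral>t. (g t * cis (x * t) - cnj (g t) * cis (x * t)) / (2 * \<i>) \<partial>lborel)"
      unfolding fourier_def
      unfolding Im by (intro Bochner_Integration.integral_cong) (auto simp: left_diff_distrib)
    also have "\<dots> = (fourier g x - fourier (\<lambda>t. cnj (g t)) x) / (2 * \<i>)"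
      unfolding fourier_def using integrable_mult_cis[OF g] integrable_mult_cis[OF ic] by simp
    finally show ?thesis .
  qed
  ultimately have "fourier (\<lambda>t. of_real (Re (g t))) x = 0" "fourier (\<lambda>t. of_real (Im (g t))) x = 0" for x
    by (simp_all add: F cnj)
  then have "AE t in lborel. Re (g t) = 0" "AE t in lborel. Im (g t) = 0"
    using g by (auto intro!: fourier_of_real_eq_0)
  then show ?thesis by eventually_elim (simp add: complex_eq_iff)
qed

text \<open>
  A nonempty open set is not null, so a continuous function that vanishes almost everywhere
  vanishes identically.
\<close>
lemma AE_fourier_eq_0_imp_AE_eq_0:
  assumes g: "integrable lborel g" and AE: "AE x in lborel. fourier g x = 0"
  shows "AE t in lborel. g t = 0"
proof (rule fourier_eq_0_imp_AE_eq_0[OF g])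
  have "open {x. fourier g x \<noteq> 0}"
    by (intro open_Collect_neq continuous_on_fourier[OF g] continuous_intros)
  moreover have "{x. fourier g x \<noteq> 0} \<in> null_sets lborel"
    using AE borel_measurable_fourier[OF g] AE_iff_null[of lborel "\<lambda>x. fourier g x = 0"] by simp
  ultimately show "fourier g x = 0" for x
    using open_not_negligible null_sets_completionI negligible_iff_null_sets by blast
qed

section \<open>Functions orthogonal to all characters of a period\<close>

lemma fourier_add:
  "integrable lborel g \<Longrightarrow> integrable lborel h \<Longrightarrow> fourier (\<lambda>t. g t + h t) x = fourier g x + fourier h x"
  unfolding fourier_def ring_distribs by (intro Bochner_Integration.integral_add integrable_mult_cis)

lemma fourier_cmult: "fourier (\<lambda>t. c * g t) x = c * fourier g x"
  unfolding fourier_def by (simp add: mult.assoc)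

lemma fourier_modulation: "fourier (\<lambda>t. g t * cis (y * t)) x = fourier g (x + y)"
  unfolding fourier_def by (simp add: mult.assoc cis_mult distrib_right add.commute)

text \<open>
  The functions whose transform vanishes at every integer multiple of \<open>w\<close> form a module over the
  trigonometric polynomials of period \<open>2 * pi / w\<close>, because multiplication by \<open>cis (w * t)\<close> only
  shifts the lattice of frequencies by one step. A real polynomial in the real and imaginary part of
  a point of the circle is such a trigonometric polynomial. The induction needs integrability of the
  product together with the vanishing, since the product case feeds one factor into the other.
\<close>
lemma real_polynomial_cis:
  fixes q :: "complex \<Rightarrow> real"
  assumes "real_polynomial_function q" "integrable lborel h"
    and "\<And>n::int. fourier h (w * of_int n) = 0"
  shows "integrable lborel (\<lambda>t. of_real (q (cis (w * t))) * h t)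
     \<and> (\<forall>n::int. fourier (\<lambda>t. of_real (q (cis (w * t))) * h t) (w * of_int n) = 0)"
  using assms
proof (induction arbitrary: h)
  case (linear f)
  define A where "A = (of_real (f 1) - \<i> * of_real (f \<i>)) / 2"
  have f: "of_real (f (cis u)) * z = A * (z * cis u) + cnj A * (z * cis (- u))" for u z
  proof -
    interpret bounded_linear f by fact
    have "cis u = cos u *\<^sub>R 1 + sin u *\<^sub>R \<i>"
      by (simp add: complex_eq_iff)
    then have "f (cis u) = cos u * f 1 + sin u * f \<i>"
      by (simp add: add scaleR)
    moreover have "complex_of_real (cos u * f 1 + sin u * f \<i>) = A * cis u + cnj A * cis (- u)"
      by (simp add: A_def complex_eq_iff field_simps)
    ultimately have "complex_of_real (f (cis u)) = A * cis u + cnj A * cis (- u)" by simp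
    then show ?thesis by (simp add: algebra_simps)
  qed
  have i: "integrable lborel (\<lambda>t. h t * cis (w * t))" "integrable lborel (\<lambda>t. h t * cis (- w * t))"
    using linear(2) by (intro integrable_mult_cis; simp)+
  have "fourier h (w * of_int n + w) = 0" "fourier h (w * of_int n + - w) = 0" for n
    using linear(3)[of "n + 1"] linear(3)[of "n - 1"] by (simp_all add: algebra_simps)
  then show ?case using i unfolding f
    by (auto simp: fourier_add fourier_cmult fourier_modulation fourier_modulation[of h "- w", simplified])
next
  case (const c)
  then show ?case by (auto simp: fourier_cmult)
next
  case (add f g)
  then show ?case by (auto simp: fourier_add ring_distribs)
next
  case (mult f g)
  show ?case
    using mult.IH(1)[of "\<lambda>t. of_real (g (cis (w * t))) * h t"] mult.IH(2)[OF mult.prems] 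
    by (simp add: mult.assoc)
qed

text \<open>
  Stone--Weierstrass on the unit circle: continuous functions on it are uniform limits of real
  polynomials, and \<open>h\<close> is integrable.
\<close>
lemma integral_continuous_cis:
  fixes F :: "complex \<Rightarrow> real"
  assumes h: "integrable lborel h" and 0: "\<And>n::int. fourier h (w * of_int n) = 0"
    and F: "continuous_on UNIV F"
  shows "(\<integral>t. of_real (F (cis (w * t))) * h t \<partial>lborel) = 0"
proof -
  let ?I = "\<integral>t. of_real (F (cis (w * t))) * h t \<partial>lborel"
  note [measurable] = borel_measurable_continuous_onI[OF F]
  obtain C where C: "\<bar>F z\<bar> \<le> C" if "z \<in> sphere 0 1" for z
  proof -
    have "bounded (F ` sphere 0 1)"
      by (intro compact_imp_bounded compact_continuous_image continuous_on_subset[OF F]) auto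
    then obtain C where "\<forall>z\<in>sphere 0 1. \<bar>F z\<bar> \<le> C"
      by (auto simp: bounded_iff)
    then show ?thesis using that by blast
  qed
  have iF: "integrable lborel (\<lambda>t. of_real (F (cis (w * t))) * h t)"
    by (subst mult.commute) (rule integrable_mult_bounded[OF h, where C = C], use C in auto)
  have le: "norm ?I \<le> e * (\<integral>t. norm (h t) \<partial>lborel)" if e: "e > 0" for e
  proof -
    obtain q where q: "real_polynomial_function q" "\<And>z. z \<in> sphere 0 1 \<Longrightarrow> \<bar>F z - q z\<bar> < e"
      by (rule Stone_Weierstrass_real_polynomial_function
            [OF compact_sphere continuous_on_subset[OF F subset_UNIV] e]) blast
    note p = real_polynomial_cis[OF q(1) h 0]
    have "(\<integral>t. of_real (q (cis (w * t))) * h t \<partial>lborel) = 0"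
      using p[THEN conjunct2, rule_format, of 0] by (simp add: fourier_def)
    then have "?I = (\<integral>t. of_real (F (cis (w * t))) * h t - of_real (q (cis (w * t))) * h t \<partial>lborel)"
      using iF p by (subst Bochner_Integration.integral_diff) auto
    also have "norm \<dots> \<le> (\<integral>t. e * norm (h t) \<partial>lborel)"
    proof (rule Bochner_Integration.integral_norm_bound_integral)
      show "norm (of_real (F (cis (w * t))) * h t - of_real (q (cis (w * t))) * h t) \<le> e * norm (h t)" for t
      proof -
        have "norm (of_real (F (cis (w * t))) * h t - of_real (q (cis (w * t))) * h t)
            = \<bar>F (cis (w * t)) - q (cis (w * t))\<bar> * norm (h t)"
          by (simp add: norm_mult left_diff_distrib[symmetric] of_real_diff[symmetric] del: of_real_diff)
        also have "\<dots> \<le> e * norm (h t)"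
          using q(2)[of "cis (w * t)"] by (intro mult_right_mono) auto
        finally show ?thesis .
      qed
    qed (use iF p h in auto)
    also have "\<dots> = e * (\<integral>t. norm (h t) \<partial>lborel)" by simp
    finally show ?thesis .
  qed
  have "((\<lambda>e. e * (\<integral>t. norm (h t) \<partial>lborel)) \<longlongrightarrow> 0 * (\<integral>t. norm (h t) \<partial>lborel)) (at_right 0)"
    by (intro tendsto_intros)
  then have "norm ?I \<le> 0"
    by (intro tendsto_lowerbound[where F = "at_right 0" and f = "\<lambda>e. e * (\<integral>t. norm (h t) \<partial>lborel)"])
       (auto intro!: le eventually_mono[OF eventually_at_right_less])
  then show ?thesis by simp
qed

text \<open>
  Uniqueness for Fourier coefficients, in the form that the periodization argument needs: the
  integral of \<open>h\<close> over every Borel set of period \<open>2 * pi / w\<close> is zero. Periodic sets are written as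
  preimages of Borel sets \<open>B\<close> of complex numbers, of which only the part on the unit circle matters.
  The sets \<open>B\<close> with this property form a Dynkin system, and it contains the closed sets because their
  indicators are bounded pointwise limits of continuous functions.
\<close>
lemma periodic_set_integral_eq_0:
  assumes h: "integrable lborel h" and 0: "\<And>n::int. fourier h (w * of_int n) = 0"
    and B: "B \<in> sets borel"
  shows "(LINT t:{t. cis (w * t) \<in> B}|lborel. h t) = 0"
proof -
  note [measurable] = borel_measurable_integrable[OF h]
  have "sets borel = sigma_sets UNIV {C :: complex set. closed C}"
    by (simp add: borel_eq_closed)
  with B have B': "B \<in> sigma_sets UNIV {C. closed C}" by simp
  have stable: "Int_stable {C :: complex set. closed C}"
    by (auto simp: Int_stable_def)
  have sub: "{C :: complex set. closed C} \<subseteq> Pow UNIV" by auto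
  have vi [measurable]: "{t. cis (w * t) \<in> B} \<in> sets lborel" if "B \<in> sigma_sets UNIV {C. closed C}" for B
  proof -
    have [measurable]: "B \<in> sets borel" using that by (simp add: borel_eq_closed)
    show ?thesis by measurable
  qed
  from stable sub B' show ?thesis
  proof (induction rule: sigma_sets_induct_disjoint)
    case (basic C)
    then have C: "closed C" by simp
    then have [measurable]: "C \<in> sets borel" by (rule borel_closed)
    show ?case
    proof (cases "C = {}")
      case False
      \<comment> \<open>\<open>infdist z C\<close> measures the distance only for nonempty \<open>C\<close>, hence the case distinction\<close>
      define F where "F n z = max 0 (1 - real n * infdist z C)" for n z
      have Fc: "continuous_on UNIV (F n)" for n
        unfolding F_def by (intro continuous_intros)
      note [measurable] = borel_measurable_continuous_onI[OF Fc]
      have lim: "(\<lambda>n. F n z) \<longlonglongrightarrow> indicator C z" for z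
      proof (cases "z \<in> C")
        case True
        then show ?thesis by (simp add: F_def)
      next
        case z: False
        then have "infdist z C > 0"
          using C False in_closed_iff_infdist_zero[of C z] infdist_nonneg[of z C] by force
        then obtain N where N: "1 < real N * infdist z C"
          using ex_less_of_nat_mult by blast
        have "F n z = 0" if "n \<ge> N" for n
        proof -
          have "real N * infdist z C \<le> real n * infdist z C"
            using that by (intro mult_right_mono) (auto simp: infdist_nonneg)
          with N show ?thesis by (simp add: F_def)
        qed
        then have "eventually (\<lambda>n. F n z = 0) sequentially"
          by (auto simp: eventually_sequentially)
        then show ?thesis using z by (simp add: tendsto_eventually)
      qed
      have "(\<lambda>n. \<integral>t. of_real (F n (cis (w * t))) * h t \<partial>lborel)
          \<longlonglongrightarrow> (\<integral>t. of_real (indicator C (cis (w * t))) * h t \<partial>lborel)"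
      proof (rule integral_dominated_convergence[where w = "\<lambda>t. norm (h t)"])
        show "AE t in lborel. (\<lambda>n. of_real (F n (cis (w * t))) * h t) \<longlonglongrightarrow> of_real (indicator C (cis (w * t))) * h t"
          using lim by (intro AE_I2 tendsto_intros)
        have "norm (of_real (F n z) * y) \<le> norm y" for n z and y :: complex
        proof -
          have "\<bar>F n z\<bar> \<le> 1" unfolding F_def using infdist_nonneg[of z C] by auto
          then show ?thesis by (simp add: norm_mult mult_left_le_one_le)
        qed
        then show "AE t in lborel. norm (of_real (F n (cis (w * t))) * h t) \<le> norm (h t)" for n
          by simp
        show "(\<lambda>t. of_real (indicator C (cis (w * t))) * h t) \<in> borel_measurable lborel"
          by measurable
        show "(\<lambda>t. of_real (F n (cis (w * t))) * h t) \<in> borel_measurable lborel" for n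
          by measurable
        show "integrable lborel (\<lambda>t. norm (h t))"
          using h by simp
      qed
      moreover have "(\<integral>t. of_real (F n (cis (w * t))) * h t \<partial>lborel) = 0" for n
        by (rule integral_continuous_cis[OF h 0 Fc])
      ultimately have "(\<integral>t. of_real (indicator C (cis (w * t))) * h t \<partial>lborel) = 0"
        by (simp add: LIMSEQ_const_iff)
      moreover have "indicator {t. cis (w * t) \<in> C} t = (indicator C (cis (w * t)) :: real)" for t
        by (simp add: indicator_def)
      ultimately show ?thesis
        by (simp add: set_lebesgue_integral_def scaleR_conv_of_real)
    qed (simp add: set_lebesgue_integral_def)
  next
    case empty
    then show ?case by (simp add: set_lebesgue_integral_def)
  next
    case (compl A)
    have "(LINT t:{t. cis (w * t) \<in> UNIV - A}|lborel. h t)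
        = (\<integral>t. h t - indicator {t. cis (w * t) \<in> A} t *\<^sub>R h t \<partial>lborel)"
      unfolding set_lebesgue_integral_def
      by (intro Bochner_Integration.integral_cong) (auto simp: indicator_def)
    also have "\<dots> = (\<integral>t. h t \<partial>lborel) - (LINT t:{t. cis (w * t) \<in> A}|lborel. h t)"
      unfolding set_lebesgue_integral_def
      using h integrable_mult_indicator[OF vi[OF compl(1)] h] by simp
    also have "\<dots> = 0" using compl(2) 0[of 0] by (simp add: fourier_def)
    finally show ?case .
  next
    case (union A)
    have *: "{t. cis (w * t) \<in> \<Union> (range A)} = (\<Union>i. {t. cis (w * t) \<in> A i})" by auto
    have m: "{t. cis (w * t) \<in> A i} \<in> sets lborel" for i
      using union by (intro vi) auto
    have "(LINT t:{t. cis (w * t) \<in> \<Union> (range A)}|lborel. h t) = (\<Sum>i. LINT t:{t. cis (w * t) \<in> A i}|lborel. h t)"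
      unfolding *
    proof (rule lebesgue_integral_countable_add)
      show "set_integrable lborel (\<Union>i. {t. cis (w * t) \<in> A i}) h"
        unfolding set_integrable_def using m h by (intro integrable_mult_indicator) auto
    qed (use m union(1) in \<open>auto simp: disjoint_family_on_def\<close>)
    then show ?case using union(3) by (simp only: suminf_zero)
  qed
qed

section \<open>Periods and lattices on the line\<close>

lemma borel_measurable_Arg2pi [measurable]: "Arg2pi \<in> borel_measurable borel"
proof -
  let ?S = "- {z. Im z = 0 \<and> 0 \<le> Re z}"
  have "closed {z. Im z = 0 \<and> 0 \<le> Re z}"
    by (intro closed_Collect_conj closed_Collect_eq closed_Collect_le continuous_intros)
  then have "open ?S" by (rule open_Compl)
  have "continuous_on ?S Arg2pi"
    by (rule continuous_at_imp_continuous_on)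
       (auto intro!: continuous_at_Arg2pi simp: complex_nonneg_Reals_iff)
  then have "(\<lambda>z. indicator ?S z *\<^sub>R Arg2pi z) \<in> borel_measurable borel"
    using \<open>open ?S\<close> by (intro borel_measurable_continuous_on_indicator) auto
  moreover have "(\<lambda>z. indicator ?S z *\<^sub>R Arg2pi z) = Arg2pi"
    by (auto simp: fun_eq_iff indicator_def Arg2pi_eq_0 complex_is_Real_iff)
  ultimately show ?thesis by simp
qed

lemma Arg2pi_cis: "0 \<le> x \<Longrightarrow> x < 2 * pi \<Longrightarrow> Arg2pi (cis x) = x"
  by (rule Arg2pi_unique[of 1]) (auto simp: cis_conv_exp)

text \<open>
  Reduction of a real number to the fundamental period \<open>{0..<2 * pi}\<close>.
\<close>
lemma Arg2pi_cis_obtain: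
  obtains n :: int where "Arg2pi (cis x) = x + 2 * pi * of_int n"
proof -
  have "cis (Arg2pi (cis x)) = cis x"
    using Arg2pi_eq[of "cis x"] by (simp add: cis_conv_exp)
  then have "sin (Arg2pi (cis x)) = sin x \<and> cos (Arg2pi (cis x)) = cos x"
    by (simp add: complex_eq_iff)
  then obtain n :: int where "Arg2pi (cis x) = x + 2 * pi * of_int n"
    unfolding sin_cos_eq_iff by blast
  then show ?thesis by (rule that)
qed

text \<open>
  The translates of a half-open interval of length \<open>T\<close> by the multiples of \<open>T\<close> tile the line, so
  \<open>U\<close> is the disjoint union of its pieces, and each piece is moved back to the base interval. The
  integers are enumerated by \<^const>\<open>int_decode\<close> to make this a series.
\<close>
lemma suminf_emeasure_tiles:
  fixes U :: "real set"
  assumes [measurable]: "U \<in> sets borel" and T: "T > 0"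
  shows "(\<Sum>k. emeasure lborel {t \<in> {a..<a+T}. t + T * of_int (int_decode k) \<in> U}) = emeasure lborel U"
proof -
  let ?J = "\<lambda>n::int. {a + T * of_int n..<a + T * of_int n + T}"
  have "emeasure lborel {t \<in> {a..<a+T}. t + T * of_int n \<in> U} = emeasure lborel (U \<inter> ?J n)" for n
  proof -
    have "emeasure lborel (U \<inter> ?J n) = emeasure (distr lborel borel ((+) (T * of_int n))) (U \<inter> ?J n)"
      by (simp add: lborel_distr_plus)
    also have "\<dots> = emeasure lborel ((+) (T * of_int n) -` (U \<inter> ?J n))"
      by (subst emeasure_distr) auto
    also have "(+) (T * of_int n) -` (U \<inter> ?J n) = {t \<in> {a..<a+T}. t + T * of_int n \<in> U}"
      by (auto simp: add.commute)
    finally show ?thesis by simp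
  qed
  then have "(\<Sum>k. emeasure lborel {t \<in> {a..<a+T}. t + T * of_int (int_decode k) \<in> U})
      = (\<Sum>k. emeasure lborel (U \<inter> ?J (int_decode k)))"
    by simp
  also have "\<dots> = emeasure lborel (\<Union>k. U \<inter> ?J (int_decode k))"
  proof (rule suminf_emeasure)
    show "disjoint_family (\<lambda>k. U \<inter> ?J (int_decode k))"
      unfolding disjoint_family_on_def
    proof (intro ballI impI)
      fix j k :: nat assume "j \<noteq> k"
      then have "int_decode j \<noteq> int_decode k"
        by (simp add: inj_eq[OF inj_int_decode])
      then have "int_decode j + 1 \<le> int_decode k \<or> int_decode k + 1 \<le> int_decode j"
        by auto
      then have "of_int (int_decode j) + 1 \<le> (of_int (int_decode k) :: real)
          \<or> of_int (int_decode k) + 1 \<le> (of_int (int_decode j) :: real)"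
        by linarith
      then have "T * (of_int (int_decode j) + 1) \<le> T * of_int (int_decode k)
          \<or> T * (of_int (int_decode k) + 1) \<le> T * of_int (int_decode j)"
        using T by auto
      then show "(U \<inter> ?J (int_decode j)) \<inter> (U \<inter> ?J (int_decode k)) = {}"
        by (auto simp: distrib_left)
    qed
  qed auto
  also have "(\<Union>k. U \<inter> ?J (int_decode k)) = U"
  proof -
    have "\<exists>k. t \<in> ?J (int_decode k)" for t
    proof -
      define n where "n = \<lfloor>(t - a) / T\<rfloor>"
      have "of_int n \<le> (t - a) / T" "(t - a) / T < of_int n + 1"
        unfolding n_def by linarith+
      then have "t \<in> ?J n"
        using T by (auto simp: field_simps)
      then show ?thesis by (metis int_encode_inverse)
    qed
    then show ?thesis by blast
  qed
  finally show ?thesis .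
qed

text \<open>
  The points of the period some translate of which meets \<open>g \<noteq> 0\<close> have total measure at most that of
  \<open>g \<noteq> 0\<close>, by the tiling. If that is less than \<open>T\<close>, the period is not exhausted.
\<close>
lemma emeasure_periodic_zeros_pos:
  fixes g :: "real \<Rightarrow> complex"
  assumes [measurable]: "g \<in> borel_measurable borel" and T: "T > 0"
    and small: "emeasure lborel {t. g t \<noteq> 0} < ennreal T"
  shows "emeasure lborel {t \<in> {0..<T}. \<forall>n::int. g (t + T * of_int n) = 0} > 0"
proof (rule ccontr)
  let ?Z = "{t \<in> {0..<T}. \<forall>n::int. g (t + T * of_int n) = 0}"
  let ?A = "\<lambda>k. {t \<in> {0..<0+T}. t + T * of_int (int_decode k) \<in> {t. g t \<noteq> 0}}"
  assume "\<not> emeasure lborel ?Z > 0"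
  then have Z: "emeasure lborel ?Z = 0" by simp
  have "t \<in> ?Z \<union> (\<Union>k. ?A k)" if "t \<in> {0..<T}" for t
  proof (cases "\<forall>n::int. g (t + T * of_int n) = 0")
    case False
    then obtain n :: int where "g (t + T * of_int n) \<noteq> 0" by blast
    then have "t \<in> ?A (int_encode n)" using that by simp
    then show ?thesis by blast
  qed (use that in auto)
  then have "{0..<T} \<subseteq> ?Z \<union> (\<Union>k. ?A k)" by blast
  then have "emeasure lborel {0..<T} \<le> emeasure lborel (?Z \<union> (\<Union>k. ?A k))"
    by (intro emeasure_mono) (auto intro!: sets.Un sets.countable_UN)
  also have "\<dots> \<le> emeasure lborel ?Z + emeasure lborel (\<Union>k. ?A k)"
    by (intro emeasure_subadditive) auto
  also have "\<dots> \<le> 0 + (\<Sum>k. emeasure lborel (?A k))"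
    unfolding Z by (intro add_left_mono emeasure_subadditive_countably) auto
  also have "\<dots> = emeasure lborel {t. g t \<noteq> 0}"
    using suminf_emeasure_tiles[of "{t. g t \<noteq> 0}" T 0] T by simp
  finally show False using small T by simp
qed

lemma fourier_trig_mult:
  assumes f: "integrable lborel f" and "finite A"
  shows "fourier (\<lambda>t. f t * (\<Sum>k\<in>A. c k * cis (y k * t))) x = (\<Sum>k\<in>A. c k * fourier f (x + y k))"
proof -
  have "fourier (\<lambda>t. f t * (\<Sum>k\<in>A. c k * cis (y k * t))) x
      = (\<integral>t. (\<Sum>k\<in>A. c k * (f t * cis ((x + y k) * t))) \<partial>lborel)"
    unfolding fourier_def
    by (intro Bochner_Integration.integral_cong)
       (auto simp: sum_distrib_left sum_distrib_right distrib_right cis_mult[symmetric] intro!: sum.cong)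
  also have "\<dots> = (\<Sum>k\<in>A. c k * fourier f (x + y k))"
    unfolding fourier_def using integrable_mult_cis[OF f]
    by (subst Bochner_Integration.integral_sum) auto
  finally show ?thesis .
qed

text \<open>
  Orthogonality of the characters on one period.
\<close>
lemma fourier_indicator_period:
  assumes w: "w > 0"
  shows "fourier (indicator {0..2 * pi / w}) (w * of_int n) = (if n = 0 then of_real (2 * pi / w) else 0)"
proof (cases "n = 0")
  case True
  have "fourier (indicator {0..2 * pi / w}) 0 = (\<integral>t. of_real (indicator {0..2 * pi / w} t) \<partial>lborel)"
    unfolding fourier_def by (intro Bochner_Integration.integral_cong) (auto simp: indicator_def)
  also have "\<dots> = of_real (2 * pi / w)"
    using w by (simp only: integral_complex_of_real) simp
  finally show ?thesis using True by simp
next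
  case False
  define v where "v = w * of_int n"
  have v: "v \<noteq> 0" using False w by (simp add: v_def)
  let ?F = "\<lambda>t. cis (v * t) / (\<i> * of_real v)"
  have "has_bochner_integral lborel (\<lambda>t. indicator {0..2 * pi / w} t *\<^sub>R cis (v * t)) (?F (2 * pi / w) - ?F 0)"
  proof (rule has_bochner_integral_FTC_Icc)
    show "(?F has_vector_derivative cis (v * t)) (at t within {0..2 * pi / w})" for t
    proof -
      let ?G = "\<lambda>z. exp (\<i> * of_real v * z) / (\<i> * of_real v)"
      have "(?G has_field_derivative exp (\<i> * of_real v * of_real t)) (at (of_real t))"
        by (auto intro!: derivative_eq_intros simp: v)
      from has_vector_derivative_real_field[OF this] show ?thesis
        by (simp add: cis_conv_exp mult.assoc)
    qed
  qed (use w in \<open>auto intro!: continuous_intros\<close>)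
  moreover have "cis (v * (2 * pi / w)) = 1"
    using w cis_multiple_2pi[of "of_int n"] by (simp add: v_def mult_ac)
  ultimately have "(\<integral>t. indicator {0..2 * pi / w} t *\<^sub>R cis (v * t) \<partial>lborel) = 0"
    by (simp add: has_bochner_integral_iff)
  moreover have "indicator {0..2 * pi / w} t *\<^sub>R cis (v * t) = indicator {0..2 * pi / w} t * cis (v * t)" for t
    by (simp add: indicator_def)
  ultimately show ?thesis
    using False by (simp add: fourier_def v_def)
qed

text \<open>
  On one period the exponential is injective, so zeros of a trigonometric polynomial correspond to
  roots of an ordinary polynomial.
\<close>
lemma finite_trig_zeros:
  assumes "P \<noteq> 0" and w: "w > 0"
  shows "finite {t \<in> {0..<2 * pi / w}. poly P (cis (- (w * t))) = 0}" (is "finite ?Z")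
proof (rule finite_imageD)
  show "finite ((\<lambda>t. cis (- (w * t))) ` ?Z)"
    by (rule finite_subset[OF _ poly_roots_finite[OF assms(1)]]) auto
  show "inj_on (\<lambda>t. cis (- (w * t))) ?Z"
  proof (rule inj_onI)
    fix s t assume st: "s \<in> ?Z" "t \<in> ?Z" "cis (- (w * s)) = cis (- (w * t))"
    then have "cnj (cis (- (w * s))) = cnj (cis (- (w * t)))" by simp
    then have "Arg2pi (cis (w * s)) = Arg2pi (cis (w * t))" by (simp add: cis_cnj)
    moreover have "0 \<le> w * u" "w * u < 2 * pi" if "u \<in> ?Z" for u
      using that w by (auto simp: field_simps)
    ultimately show "s = t"
      using st w by (simp add: Arg2pi_cis)
  qed
qed

text \<open>
  On one tile \<open>{w * j..<w * j + w}\<close> the sets of those \<open>x\<close> with \<open>x + w * n \<in> U\<close>, taken over all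
  \<open>n\<close>, have measures that add up to the measure of \<open>U\<close>. By Borel--Cantelli almost every \<open>x\<close> of the
  tile lies in only finitely many of them.
\<close>
lemma AE_finite_lattice_points:
  fixes U :: "real set"
  assumes [measurable]: "U \<in> sets borel" and fin: "emeasure lborel U < \<infinity>" and w: "w > 0"
  shows "AE x in lborel. finite {n::int. x + w * of_int n \<in> U}"
proof -
  have "AE x in lborel. x \<in> {w * of_int j..<w * of_int j + w} \<longrightarrow> finite {n::int. x + w * of_int n \<in> U}" for j :: int
  proof -
    define A where "A k = {x \<in> {w * of_int j..<w * of_int j + w}. x + w * of_int (int_decode k) \<in> U}" for k
    have A: "A k \<in> sets lborel" for k unfolding A_def by measurable
    have sum: "(\<Sum>k. emeasure lborel (A k)) < \<infinity>"
      unfolding A_def using suminf_emeasure_tiles[of U w "w * of_int j"] w fin by simp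
    have Afin: "emeasure lborel (A k) < \<infinity>" for k
    proof -
      have "emeasure lborel (A k) \<le> emeasure lborel {w * of_int j..<w * of_int j + w}"
        by (intro emeasure_mono) (auto simp: A_def)
      also have "\<dots> < \<infinity>" using w by simp
      finally show ?thesis .
    qed
    have "summable (\<lambda>k. measure lborel (A k))"
      using sum Afin
      by (intro summable_suminf_not_top) (auto simp: emeasure_eq_ennreal_measure[symmetric] less_top)
    from borel_cantelli_AE1[OF A Afin this]
    have "AE x in lborel. eventually (\<lambda>k. x \<in> space lborel - A k) sequentially" .
    then show ?thesis
    proof eventually_elim
      case (elim x)
      show ?case
      proof
        assume x: "x \<in> {w * of_int j..<w * of_int j + w}"
        obtain N where N: "\<And>k. k \<ge> N \<Longrightarrow> x \<notin> A k"
          using elim by (auto simp: eventually_sequentially)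
        have "{n::int. x + w * of_int n \<in> U} \<subseteq> int_decode ` {..<N}"
        proof
          fix n assume "n \<in> {n::int. x + w * of_int n \<in> U}"
          then have "x \<in> A (int_encode n)" using x by (simp add: A_def)
          then have "int_encode n < N" using N not_le by blast
          then show "n \<in> int_decode ` {..<N}"
            by (metis imageI int_encode_inverse lessThan_iff)
        qed
        then show "finite {n::int. x + w * of_int n \<in> U}"
          by (rule finite_subset) simp
      qed
    qed
  qed
  then have "AE x in lborel. \<forall>j::int. x \<in> {w * of_int j..<w * of_int j + w} \<longrightarrow> finite {n::int. x + w * of_int n \<in> U}"
    by (subst AE_all_countable) (rule allI)
  then show ?thesis
  proof eventually_elim
    case (elim x)
    define j where "j = \<lfloor>x / w\<rfloor>"
    have "of_int j \<le> x / w" "x / w < of_int j + 1" unfolding j_def by linarith+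
    then have "x \<in> {w * of_int j..<w * of_int j + w}"
      using w by (auto simp: field_simps)
    with elim show ?case by blast
  qed
qed

section \<open>Benedicks' theorem\<close>

text \<open>
  The heart of the argument. Put \<open>T = 2 * pi / w\<close>. The values of the transform at the multiples of
  \<open>w\<close> are, up to the factor \<open>T\<close>, the Fourier coefficients of the \<open>T\<close>-periodization of \<open>g\<close>. As only
  finitely many are nonzero, this periodization is a trigonometric polynomial \<open>p\<close>. But \<open>g\<close> lives on a
  set too small to cover a period modulo \<open>T\<close>, so the periodization vanishes on a set of positive
  measure, which forces \<open>p = 0\<close>.

  The proof does not form the periodization as a series. It compares \<open>g\<close> with \<open>p\<close> restricted to one
  period: the difference \<open>h\<close> is orthogonal to all characters, and so is \<open>h\<close> times the conjugate of \<open>p\<close>.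
  Integrating the latter over the periodic set \<open>cis (w * t) \<in> B\<close>, none of whose points is a point
  where \<open>g\<close> is nonzero, leaves only minus the integral of \<open>\<bar>p\<bar>\<^sup>2\<close> over that set within one period.
\<close>
lemma fourier_lattice_eq_0:
  assumes g: "integrable lborel g" and w: "w > 0"
    and small: "emeasure lborel {t. g t \<noteq> 0} < ennreal (2 * pi / w)"
    and band: "\<And>n::int. n \<notin> {0..int K} \<Longrightarrow> fourier g (w * of_int n) = 0"
  shows "fourier g (w * of_int n) = 0"
proof -
  note [measurable] = borel_measurable_integrable[OF g]
  define T where "T = 2 * pi / w"
  have T: "T > 0" and wT: "w * T = 2 * pi" using w by (auto simp: T_def)
  define c where "c k = fourier g (w * real k) / of_real T" for k
  \<comment> \<open>the trigonometric polynomial with the Fourier coefficients of the periodization of \<open>g\<close>\<close>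
  define p where "p t = (\<Sum>k\<le>K. c k * cis (- (w * real k) * t))" for t
  define h where "h t = g t - indicator {0..T} t * p t" for t
  \<comment> \<open>\<open>cis (w * t) \<in> B\<close> iff \<open>g\<close> vanishes at all translates of \<open>t\<close> by multiples of \<open>T\<close>\<close>
  define B where "B = {z. \<forall>n::int. g (Arg2pi z / w + T * of_int n) = 0}"
  have [measurable]: "p \<in> borel_measurable borel" unfolding p_def[abs_def] by measurable
  have [measurable]: "B \<in> sets borel"
    unfolding B_def by measurable
  have p_bound: "norm (p t) \<le> (\<Sum>k\<le>K. norm (c k))" for t
    unfolding p_def by (rule order_trans[OF norm_sum]) (simp add: norm_mult)
  have "integrable lborel (\<lambda>t. complex_of_real (indicator {0..T} t))"
    using T by (intro integrable_of_real integrable_real_indicator) auto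
  moreover have "complex_of_real (indicator {0..T} t) = indicator {0..T} t" for t
    by (simp add: indicator_def)
  ultimately have iI: "integrable lborel (\<lambda>t. indicator {0..T} t :: complex)" by simp
  have iIp: "integrable lborel (\<lambda>t. indicator {0..T} t * p t)"
    by (rule integrable_mult_bounded[OF iI _ p_bound]) simp
  have ih: "integrable lborel h"
    unfolding h_def[abs_def] using g iIp by simp

  have F_Ip: "fourier (\<lambda>t. indicator {0..T} t * p t) (w * of_int n) = fourier g (w * of_int n)" for n
  proof -
    have "fourier (\<lambda>t. indicator {0..T} t * p t) (w * of_int n)
        = (\<Sum>k\<le>K. c k * fourier (indicator {0..T}) (w * of_int n + - (w * real k)))"
      unfolding p_def[abs_def] by (rule fourier_trig_mult) (use iI in auto)
    also have "\<dots> = (\<Sum>k\<le>K. c k * fourier (indicator {0..T}) (w * of_int (n - int k)))"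
      by (simp add: algebra_simps)
    also have "\<dots> = (\<Sum>k\<le>K. if n = int k then fourier g (w * of_int n) else 0)"
      unfolding fourier_indicator_period[OF w, folded T_def]
      using T by (intro sum.cong) (auto simp: c_def)
    also have "\<dots> = fourier g (w * of_int n)"
    proof (cases "n \<in> {0..int K}")
      case True
      then have "(n = int k) = (k = nat n)" for k by auto
      then show ?thesis using True by (simp add: nat_le_iff)
    next
      case False
      show ?thesis by (simp only: band[OF False] if_cancel sum.neutral_const)
    qed
    finally show ?thesis .
  qed
  have F_h: "fourier h (w * of_int n) = 0" for n
  proof -
    have "fourier h (w * of_int n) = fourier (\<lambda>t. g t + (-1) * (indicator {0..T} t * p t)) (w * of_int n)"
      by (simp add: h_def[abs_def])
    also have "\<dots> = fourier g (w * of_int n) + (-1) * fourier (\<lambda>t. indicator {0..T} t * p t) (w * of_int n)"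
      by (subst fourier_add) (use g iIp in \<open>auto simp only: fourier_cmult integrable_mult_right\<close>)
    finally show ?thesis using F_Ip by simp
  qed
  have cnj_p: "cnj (p t) = (\<Sum>k\<le>K. cnj (c k) * cis ((w * real k) * t))" for t
    by (simp add: p_def cis_cnj)
  have ihp: "integrable lborel (\<lambda>t. h t * cnj (p t))"
    by (rule integrable_mult_bounded[OF ih, where C = "\<Sum>k\<le>K. norm (c k)"]) (auto simp: p_bound)
  have F_hp: "fourier (\<lambda>t. h t * cnj (p t)) (w * of_int n) = 0" for n
  proof -
    have "fourier (\<lambda>t. h t * cnj (p t)) (w * of_int n) = (\<Sum>k\<le>K. cnj (c k) * fourier h (w * of_int n + w * real k))"
      unfolding cnj_p by (rule fourier_trig_mult[OF ih]) simp
    also have "\<dots> = (\<Sum>k\<le>K. cnj (c k) * fourier h (w * of_int (n + int k)))"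
      by (simp add: algebra_simps)
    also have "\<dots> = 0" unfolding F_h by simp
    finally show ?thesis .
  qed

  let ?B = "{t. cis (w * t) \<in> B}"
  have g0: "g t = 0" if "t \<in> ?B" for t
  proof -
    obtain m :: int where m: "Arg2pi (cis (w * t)) = w * t + 2 * pi * of_int m"
      by (rule Arg2pi_cis_obtain)
    from that have "g (Arg2pi (cis (w * t)) / w + T * of_int (- m)) = 0"
      unfolding B_def by blast
    also have "Arg2pi (cis (w * t)) / w + T * of_int (- m) = t"
      unfolding m T_def using w by (simp add: field_simps)
    finally show ?thesis .
  qed
  have "0 = (LINT t:?B|lborel. h t * cnj (p t))"
    by (rule periodic_set_integral_eq_0[OF ihp F_hp, symmetric]) simp
  also have "\<dots> = (\<integral>t. of_real (- (indicator (?B \<inter> {0..T}) t * (norm (p t))\<^sup>2)) \<partial>lborel)"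
    unfolding set_lebesgue_integral_def
    by (intro Bochner_Integration.integral_cong)
       (auto simp: indicator_def h_def g0 complex_norm_square simp del: of_real_power)
  also have "\<dots> = of_real (- (\<integral>t. indicator (?B \<inter> {0..T}) t * (norm (p t))\<^sup>2 \<partial>lborel))"
    by (simp only: integral_complex_of_real Bochner_Integration.integral_minus)
  finally have int0: "(\<integral>t. indicator (?B \<inter> {0..T}) t * (norm (p t))\<^sup>2 \<partial>lborel) = 0"
    by simp
  have "integrable lborel (\<lambda>t. indicator (?B \<inter> {0..T}) t * (norm (p t))\<^sup>2)"
  proof (rule Bochner_Integration.integrable_bound)
    show "integrable lborel (\<lambda>t. indicator {0..T} t * (\<Sum>k\<le>K. norm (c k))\<^sup>2)"
      using T by (intro integrable_mult_left integrable_real_indicator) auto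
    show "AE t in lborel. norm (indicator (?B \<inter> {0..T}) t * (norm (p t))\<^sup>2)
        \<le> norm (indicator {0..T} t * (\<Sum>k\<le>K. norm (c k))\<^sup>2)"
      using p_bound by (intro AE_I2) (auto simp: indicator_def intro!: power_mono)
  qed measurable
  with int0 have AE0: "AE t in lborel. indicator (?B \<inter> {0..T}) t * (norm (p t))\<^sup>2 = 0"
    by (subst (asm) integral_nonneg_eq_0_iff_AE) auto

  define P where "P = (\<Sum>k\<le>K. monom (c k) k)"
  have pP: "p t = poly P (cis (- (w * t)))" for t
  proof -
    have "cis (- (w * real k) * t) = cis (- (w * t)) ^ k" for k
      unfolding Complex.DeMoivre by (simp add: mult_ac)
    then show ?thesis by (simp only: p_def P_def poly_sum poly_monom)
  qed
  \<comment> \<open>otherwise \<open>p\<close> has finitely many zeros in a period, but it vanishes almost everywhere on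
    the part of the period with \<open>cis (w * t) \<in> B\<close>, which has positive measure\<close>
  have "P = 0"
  proof (rule ccontr)
    assume "P \<noteq> 0"
    then have "finite {t \<in> {0..<T}. p t = 0}"
      unfolding pP T_def by (rule finite_trig_zeros) (rule w)
    then have "AE t in lborel. t \<notin> {t \<in> {0..<T}. p t = 0}"
      by (intro AE_not_in finite_imp_null_set_lborel)
    with AE0 have "AE t in lborel. t \<notin> {t \<in> {0..<T}. \<forall>n::int. g (t + T * of_int n) = 0}"
    proof eventually_elim
      case (elim t)
      show ?case
      proof
        assume t: "t \<in> {t \<in> {0..<T}. \<forall>n::int. g (t + T * of_int n) = 0}"
        then have "w * t < w * T" "0 \<le> w * t" using w by auto
        then have "Arg2pi (cis (w * t)) = w * t" by (simp add: Arg2pi_cis wT)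
        then have "cis (w * t) \<in> B" using t w by (simp add: B_def)
        with t elim show False by auto
      qed
    qed
    then have "emeasure lborel {t \<in> {0..<T}. \<forall>n::int. g (t + T * of_int n) = 0} = 0"
      by (subst (asm) AE_iff_null_sets[symmetric]) (measurable, rule null_setsD1)
    then show False
      using emeasure_periodic_zeros_pos[of g T] T small by (simp add: T_def)
  qed
  show ?thesis
  proof (cases "n \<in> {0..int K}")
    case True
    then have "coeff P (nat n) = c (nat n)"
      by (simp add: P_def coeff_sum nat_le_iff)
    then have "c (nat n) = 0" by (simp add: \<open>P = 0\<close>)
    then show ?thesis using True T by (simp add: c_def)
  next
    case False
    then show ?thesis by (rule band)
  qed
qed

text \<open>
  A modulation of \<open>g\<close> leaves the set \<open>g \<noteq> 0\<close> alone and moves any finite set of lattice frequencies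
  into the range \<open>{0..K}\<close>.
\<close>
lemma fourier_lattice_finite_eq_0:
  assumes g: "integrable lborel g" and w: "w > 0"
    and small: "emeasure lborel {t. g t \<noteq> 0} < ennreal (2 * pi / w)"
    and fin: "finite {n::int. fourier g (x + w * of_int n) \<noteq> 0}"
  shows "fourier g x = 0"
proof -
  \<comment> \<open>shifting by \<open>k\<close> sends the exceptional indices, which lie in \<open>{- k..k}\<close>, to \<open>{0..2 * k}\<close>\<close>
  obtain k where k: "\<And>n::int. fourier g (x + w * of_int n) \<noteq> 0 \<Longrightarrow> \<bar>n\<bar> \<le> k"
    using fin unfolding finite_int_iff_bounded_le by blast
  define h where "h t = g t * cis ((x - w * of_int k) * t)" for t
  have h: "integrable lborel h" unfolding h_def by (rule integrable_mult_cis[OF g])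
  have F: "fourier h (w * of_int n) = fourier g (x + w * of_int (n - k))" for n
    unfolding h_def by (subst fourier_modulation) (simp add: algebra_simps)
  have "fourier h (w * of_int k) = 0"
  proof (rule fourier_lattice_eq_0[OF h w])
    show "emeasure lborel {t. h t \<noteq> 0} < ennreal (2 * pi / w)"
      using small by (simp add: h_def)
    show "fourier h (w * of_int n) = 0" if "n \<notin> {0..int (nat (2 * k))}" for n
      using k[of "n - k"] that unfolding F by fastforce
  qed
  then show ?thesis by (simp add: F)
qed

text \<open>
  If \<open>g\<close> and its transform are both nonzero only on sets of finite measure, choose the spacing \<open>w\<close> so
  small that a period \<open>2 * pi / w\<close> exceeds the measure of \<open>g \<noteq> 0\<close>. For almost every \<open>x\<close> the lattice
  \<open>x + w * n\<close> meets the nonzero set of the transform finitely often, so the transform vanishes at \<open>x\<close>.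
\<close>
theorem Benedicks:
  assumes g: "integrable lborel g"
    and time: "emeasure lborel {t. g t \<noteq> 0} < \<infinity>"
    and freq: "emeasure lborel {x. fourier g x \<noteq> 0} < \<infinity>"
  shows "AE t in lborel. g t = 0"
proof (rule AE_fourier_eq_0_imp_AE_eq_0[OF g])
  note [measurable] = borel_measurable_fourier[OF g]
  \<comment> \<open>adding 1 makes the period positive and strictly larger than the measure\<close>
  define T where "T = enn2real (emeasure lborel {t. g t \<noteq> 0}) + 1"
  define w where "w = 2 * pi / T"
  have T: "T > 0" by (simp add: T_def add_nonneg_pos)
  have w: "w > 0" "2 * pi / w = T" using T by (simp_all add: w_def)
  have "emeasure lborel {t. g t \<noteq> 0} < ennreal (2 * pi / w)"
    unfolding w(2) T_def using time
    by (cases "emeasure lborel {t. g t \<noteq> 0}") (auto simp: ennreal_less_iff)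
  then show "AE x in lborel. fourier g x = 0"
    using AE_finite_lattice_points[OF _ freq w(1)]
    by (auto intro: fourier_lattice_finite_eq_0[OF g w(1)])
qed

section \<open>From the windowed transform to the Fourier transform\<close>

text \<open>
  Fubini and translation arguments are carried out with Borel functions, so elements of
  \<^const>\<open>L2_real\<close> are replaced by Borel representatives.
\<close>
lemma L2_real_borel_representative:
  assumes "f \<in> L2_real"
  obtains g where "g \<in> borel_measurable borel" "AE t in lborel. f t = g t"
    "integrable lborel (\<lambda>t. (norm (g t))\<^sup>2)"
proof -
  have f: "f \<in> borel_measurable lebesgue" and int: "integrable lebesgue (\<lambda>t. (norm (f t))\<^sup>2)"
    using assms by (auto simp: L2_real_def)
  have "(\<lambda>t. Re (f t)) \<in> borel_measurable lebesgue" "(\<lambda>t. Im (f t)) \<in> borel_measurable lebesgue"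
    using f by measurable
  then obtain r s where rs: "r \<in> borel_measurable lborel" "AE t in lborel. Re (f t) = r t"
      "s \<in> borel_measurable lborel" "AE t in lborel. Im (f t) = s t"
    by (metis completion_ex_borel_measurable_real)
  define g where "g t = Complex (r t) (s t)" for t
  have "g t = of_real (r t) + \<i> * of_real (s t)" for t
    by (simp add: g_def Complex_eq)
  then have g [measurable]: "g \<in> borel_measurable borel"
    using rs by (simp cong: measurable_cong)
  have AE: "AE t in lborel. f t = g t"
    using rs(2,4) by eventually_elim (simp add: g_def complex_eq_iff)
  have "AE t in lebesgue. (norm (f t))\<^sup>2 = (norm (g t))\<^sup>2"
    using AE_completion[OF AE] by eventually_elim simp
  then have "integrable lebesgue (\<lambda>t. (norm (g t))\<^sup>2)"
    using int by (subst (asm) integrable_cong_AE) (use f in \<open>auto intro!: measurable_completion\<close>)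
  then have "integrable lborel (\<lambda>t. (norm (g t))\<^sup>2)"
    by (subst (asm) integrable_completion) auto
  with g AE show ?thesis by (rule that)
qed

lemma integrable_mult_L2:
  fixes f g :: "'a \<Rightarrow> complex"
  assumes [measurable]: "f \<in> borel_measurable M" "g \<in> borel_measurable M"
    and "integrable M (\<lambda>t. (norm (f t))\<^sup>2)" "integrable M (\<lambda>t. (norm (g t))\<^sup>2)"
  shows "integrable M (\<lambda>t. f t * g t)"
proof (rule Bochner_Integration.integrable_bound)
  show "integrable M (\<lambda>t. (norm (f t))\<^sup>2 + (norm (g t))\<^sup>2)"
    using assms by auto
  have "norm (f t) * norm (g t) \<le> (norm (f t))\<^sup>2 + (norm (g t))\<^sup>2" for t
    using sum_squares_bound[of "norm (f t)" "norm (g t)"] mult_nonneg_nonneg[of "norm (f t)" "norm (g t)"]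
    by (simp add: mult.assoc del: mult_nonneg_nonneg)
  then show "AE t in M. norm (f t * g t) \<le> norm ((norm (f t))\<^sup>2 + (norm (g t))\<^sup>2)"
    by (simp add: norm_mult)
qed measurable

lemma AE_translate:
  fixes w :: real
  assumes "AE t in lborel. P t"
  shows "AE t in lborel. P (t - w)"
proof -
  obtain N where N: "N \<in> null_sets lborel" "{t. \<not> P t} \<subseteq> N"
    using assms by (auto simp: eventually_ae_filter)
  then have [measurable]: "N \<in> sets borel" by auto
  have "AE t in lborel. t \<notin> N" using N by (intro AE_not_in)
  then have "AE t in lborel. - w + 1 * t \<notin> N"
    by (intro AE_borel_affine) auto
  then show ?thesis
  proof eventually_elim
    case (elim t)
    then show ?case using N(2) by auto
  qed
qed

text \<open>
  Tonelli: the double integral of \<open>norm (f t) * norm (g (t - w))\<close> in \<open>t\<close> and \<open>w\<close> is the product of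
  the integrals of \<open>norm f\<close> and \<open>norm g\<close>; one order of integration shows that it is zero.
\<close>
lemma AE_mult_translates_eq_0:
  fixes f g :: "real \<Rightarrow> complex"
  assumes [measurable]: "f \<in> borel_measurable borel" "g \<in> borel_measurable borel"
    and prod: "\<And>w. AE t in lborel. f t * g (t - w) = 0"
    and g: "\<not> (AE t in lborel. g t = 0)"
  shows "AE t in lborel. f t = 0"
proof -
  define G where "G = (\<integral>\<^sup>+t. ennreal (norm (g t)) \<partial>lborel)"
  have "G \<noteq> 0"
    using g unfolding G_def by (subst nn_integral_0_iff_AE) auto
  have "(\<integral>\<^sup>+w. ennreal (norm (g (t - w))) \<partial>lborel) = G" for t
    unfolding G_def
    by (subst nn_integral_real_affine[where c = "-1" and t = t]) (auto simp: mult_1_left)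
  then have "(\<integral>\<^sup>+t. ennreal (norm (f t)) * G \<partial>lborel)
      = (\<integral>\<^sup>+t. (\<integral>\<^sup>+w. ennreal (norm (f t)) * ennreal (norm (g (t - w))) \<partial>lborel) \<partial>lborel)"
    by (subst nn_integral_cmult) auto
  also have "\<dots> = (\<integral>\<^sup>+w. (\<integral>\<^sup>+t. ennreal (norm (f t)) * ennreal (norm (g (t - w))) \<partial>lborel) \<partial>lborel)"
    by (rule lborel_pair.Fubini') measurable
  also have "\<dots> = (\<integral>\<^sup>+(w::real). 0 \<partial>lborel)"
  proof (rule nn_integral_cong)
    fix w :: real
    show "(\<integral>\<^sup>+t. ennreal (norm (f t)) * ennreal (norm (g (t - w))) \<partial>lborel) = 0"
      using prod[of w] by (subst nn_integral_0_iff_AE) auto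
  qed
  finally have "(\<integral>\<^sup>+t. ennreal (norm (f t)) * G \<partial>lborel) = 0" by simp
  then have "AE t in lborel. ennreal (norm (f t)) * G = 0"
    by (subst (asm) nn_integral_0_iff_AE) auto
  then show ?thesis
    by eventually_elim (use \<open>G \<noteq> 0\<close> in auto)
qed

text \<open>
  The part of the integrand of the windowed transform that does not depend on the frequency \<open>u\<close>:
  the windowed signal times the chirp in the kernel.
\<close>
definition demodulated ::
  "real \<Rightarrow> real \<Rightarrow> real \<Rightarrow> (real \<Rightarrow> complex) \<Rightarrow> (real \<Rightarrow> complex) \<Rightarrow> real \<Rightarrow> real \<Rightarrow> complex" where
  "demodulated a b u0 \<phi> f w t =
     f t * cnj (\<phi> (t - w)) * cis (a / (2 * b) * t\<^sup>2 + u0 * t / b)"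

text \<open>
  Expanding \<open>t * (u - u0)\<close> splits the kernel into a factor in \<open>u\<close> alone, its value at \<open>t = 0\<close>, a
  chirp in \<open>t\<close> alone, and a Fourier character of frequency \<open>- u / b\<close>.
\<close>
lemma olct_kernel_factor:
  assumes "b \<noteq> 0"
  shows "olct_kernel (a, b, c, d, u0, w0) t u = olct_kernel (a, b, c, d, u0, w0) 0 u *
    (cis (a / (2 * b) * t\<^sup>2 + u0 * t / b) * cis (- u / b * t))"
proof -
  have ker: "olct_kernel (a, b, c, d, u0, w0) t u = 1 / csqrt (\<i> * 2 * of_real pi * of_real b) *
      cis (a / (2 * b) * t\<^sup>2 - 1 / b * t * (u - u0) - 1 / b * u * (d * u0 - b * w0)
        + d / (2 * b) * (u\<^sup>2 + u0\<^sup>2))" for t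
    by (simp add: cis_conv_exp ring_distribs)
  have "cis (a / (2 * b) * t\<^sup>2 - 1 / b * t * (u - u0) - z + y)
      = cis (a / (2 * b) * 0\<^sup>2 - 1 / b * 0 * (u - u0) - z + y)
        * (cis (a / (2 * b) * t\<^sup>2 + u0 * t / b) * cis (- u / b * t))" for y z
    unfolding cis_mult using assms by (intro arg_cong[where f = cis]) (simp add: field_simps)
  then show ?thesis
    unfolding ker[of t] ker[of 0] mult.assoc by (simp only:)
qed

lemma wolct_eq_fourier:
  assumes "b \<noteq> 0"
    and [measurable]: "f \<in> borel_measurable borel" "\<phi> \<in> borel_measurable borel"
  shows "wolct (a, b, c, d, u0, w0) \<phi> f u w
    = olct_kernel (a, b, c, d, u0, w0) 0 u * fourier (demodulated a b u0 \<phi> f w) (- u / b)"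
proof -
  let ?C = "olct_kernel (a, b, c, d, u0, w0) 0 u"
  have "wolct (a, b, c, d, u0, w0) \<phi> f u w
      = (\<integral>t. ?C * (demodulated a b u0 \<phi> f w t * cis (- u / b * t)) \<partial>lebesgue)"
    unfolding wolct_def demodulated_def
    by (subst olct_kernel_factor[OF assms(1)]) (simp only: mult_ac)
  also have "\<dots> = (\<integral>t. ?C * (demodulated a b u0 \<phi> f w t * cis (- u / b * t)) \<partial>lborel)"
    unfolding demodulated_def by (intro integral_completion) measurable
  finally show ?thesis by (simp add: fourier_def)
qed

lemma olct_kernel_nonzero: "b \<noteq> 0 \<Longrightarrow> olct_kernel (a, b, c, d, u0, w0) t u \<noteq> 0"
  by simp

text \<open>
  The Bochner integral is insensitive to null sets only between measurable functions; measurability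
  for \<open>f\<close> and \<open>\<phi>\<close> comes from completeness of Lebesgue measure.
\<close>
lemma wolct_cong_AE:
  assumes f: "AE t in lborel. f t = f' t" "f' \<in> borel_measurable borel"
    and p: "AE t in lborel. \<phi> t = \<phi>' t" "\<phi>' \<in> borel_measurable borel"
  shows "wolct (a, b, c, d, u0, w0) \<phi> f u w = wolct (a, b, c, d, u0, w0) \<phi>' f' u w"
proof -
  have [measurable]: "f' \<in> borel_measurable borel" "\<phi>' \<in> borel_measurable borel" by fact+
  have "(\<lambda>t. olct_kernel (a, b, c, d, u0, w0) t u) \<in> borel_measurable borel"
    by (simp only: olct_kernel.simps) measurable
  then have m: "(\<lambda>t. f' t * cnj (\<phi>' (t - w)) * olct_kernel (a, b, c, d, u0, w0) t u) \<in> borel_measurable borel"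
    by measurable
  have AE: "AE t in lborel. f t * cnj (\<phi> (t - w)) * olct_kernel (a, b, c, d, u0, w0) t u
      = f' t * cnj (\<phi>' (t - w)) * olct_kernel (a, b, c, d, u0, w0) t u"
    using f(1) AE_translate[OF p(1), of w] by eventually_elim simp
  show ?thesis unfolding wolct_def
  proof (rule integral_cong_AE)
    show meas: "(\<lambda>t. f' t * cnj (\<phi>' (t - w)) * olct_kernel (a, b, c, d, u0, w0) t u) \<in> borel_measurable lebesgue"
      using m by (intro measurable_completion) simp
    show "(\<lambda>t. f t * cnj (\<phi> (t - w)) * olct_kernel (a, b, c, d, u0, w0) t u) \<in> borel_measurable lebesgue"
    proof (rule borel_measurable_AE[OF meas AE_completion])
      show "AE t in lborel. f' t * cnj (\<phi>' (t - w)) * olct_kernel (a, b, c, d, u0, w0) t u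
          = f t * cnj (\<phi> (t - w)) * olct_kernel (a, b, c, d, u0, w0) t u"
        using AE by eventually_elim (erule sym)
    qed
  qed (rule AE_completion[OF AE])
qed

lemma supp_subset_emeasure_le:
  assumes "supp_subset f D" "D \<in> sets lebesgue" "f \<in> borel_measurable borel"
  shows "emeasure lborel {t. f t \<noteq> 0} \<le> emeasure lebesgue D"
proof -
  have "emeasure lborel {t. f t \<noteq> 0} = emeasure lebesgue {t. f t \<noteq> 0}"
    using assms(3) by simp
  also have "\<dots> \<le> emeasure lebesgue D"
    using assms(1,2) by (intro emeasure_mono_AE) (auto simp: supp_subset_def support_on_def)
  finally show ?thesis .
qed

theorem theorem6:
  fixes a b c d u0 w0 :: real
    and \<phi> f :: "real \<Rightarrow> complex"
    and D S :: "real set"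
  assumes "a * d - b * c = 1" and "b \<noteq> 0"
    and "\<phi> \<in> L2_real" and "\<not> (AE t in lebesgue. \<phi> t = 0)"
    and "f \<in> L2_real"
    and "D \<in> sets lebesgue" and "S \<in> sets lebesgue"
    and "supp_subset f D"
    and "\<And>w. supp_subset (\<lambda>u. wolct (a, b, c, d, u0, w0) \<phi> f u w) S"
    and "emeasure lebesgue D * emeasure lebesgue S < \<infinity>"
  shows "AE t in lebesgue. f t = 0"
proof -
  obtain f' where f' [measurable]: "f' \<in> borel_measurable borel"
      and ff': "AE t in lborel. f t = f' t" and f'2: "integrable lborel (\<lambda>t. (norm (f' t))\<^sup>2)"
    by (rule L2_real_borel_representative[OF assms(5)])
  obtain \<phi>' where \<phi>' [measurable]: "\<phi>' \<in> borel_measurable borel"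
      and \<phi>\<phi>': "AE t in lborel. \<phi> t = \<phi>' t" and \<phi>'2: "integrable lborel (\<lambda>t. (norm (\<phi>' t))\<^sup>2)"
    by (rule L2_real_borel_representative[OF assms(3)])
  define g where "g w = demodulated a b u0 \<phi>' f' w" for w
  have g_nonzero: "g w t \<noteq> 0 \<longleftrightarrow> f' t * cnj (\<phi>' (t - w)) \<noteq> 0" for w t
    by (simp add: g_def demodulated_def)
  have g_int: "integrable lborel (g w)" for w
  proof -
    have "integrable lborel (\<lambda>t. (norm (\<phi>' (t - w)))\<^sup>2)"
      using lborel_integrable_real_affine[OF \<phi>'2, of 1 "- w"] by simp
    then have "integrable lborel (\<lambda>t. f' t * cnj (\<phi>' (t - w)))"
      using f'2 by (intro integrable_mult_L2) auto
    then show ?thesis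
      unfolding g_def demodulated_def by (rule integrable_mult_bounded[where C = 1]) auto
  qed
  note [measurable] = borel_measurable_fourier[OF g_int]
  have time: "emeasure lborel {t. g w t \<noteq> 0} \<le> emeasure lebesgue D" for w
  proof -
    have "supp_subset f' D"
      using assms(8) AE_completion[OF ff'] unfolding supp_subset_def
      by (rule eventually_elim2) (auto simp: support_on_def)
    then have "emeasure lborel {t. f' t \<noteq> 0} \<le> emeasure lebesgue D"
      using assms(6) f' by (rule supp_subset_emeasure_le)
    moreover have "emeasure lborel {t. g w t \<noteq> 0} \<le> emeasure lborel {t. f' t \<noteq> 0}"
      by (intro emeasure_mono) (auto simp: g_nonzero)
    ultimately show ?thesis by (rule order_trans[rotated])
  qed
  have freq: "emeasure lborel {x. fourier (g w) x \<noteq> 0} \<le> ennreal \<bar>- 1 / b\<bar> * emeasure lebesgue S" for w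
  proof -
    let ?U = "{x. fourier (g w) x \<noteq> 0}"
    have W: "wolct (a, b, c, d, u0, w0) \<phi> f u w
        = olct_kernel (a, b, c, d, u0, w0) 0 u * fourier (g w) (- u / b)" for u
      using wolct_cong_AE[OF ff' f' \<phi>\<phi>' \<phi>'] wolct_eq_fourier[OF assms(2) f' \<phi>'] by (simp only: g_def)
    have "supp_subset (\<lambda>u. fourier (g w) (- u / b)) S"
      using assms(9)[of w] olct_kernel_nonzero[OF assms(2)]
      unfolding supp_subset_def support_on_def W by (simp del: olct_kernel.simps)
    then have le: "emeasure lborel {u. fourier (g w) (- u / b) \<noteq> 0} \<le> emeasure lebesgue S"
      using assms(7) by (rule supp_subset_emeasure_le) measurable
    \<comment> \<open>the substitution \<open>x = - u / b\<close> carries the bound from \<open>u\<close> to the Fourier variable\<close>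
    have "emeasure lborel ?U = (\<integral>\<^sup>+x. indicator ?U x \<partial>lborel)"
      by simp
    also have "\<dots> = \<bar>- 1 / b\<bar> * (\<integral>\<^sup>+u. indicator ?U (0 + - 1 / b * u) \<partial>lborel)"
      by (rule nn_integral_real_affine) (use assms(2) in auto)
    also have "(\<integral>\<^sup>+u. indicator ?U (0 + - 1 / b * u) \<partial>lborel)
        = (\<integral>\<^sup>+u. indicator {u. fourier (g w) (- u / b) \<noteq> 0} u \<partial>lborel)"
      by (intro nn_integral_cong) (simp add: indicator_def)
    also have "\<dots> = emeasure lborel {u. fourier (g w) (- u / b) \<noteq> 0}"
      by simp
    finally show ?thesis using le by (simp add: mult_left_mono)
  qed
  \<comment> \<open>a finite product of extended reals allows one factor to be infinite if the other is zero\<close>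
  show ?thesis
  proof (cases "emeasure lebesgue D = 0")
    case True
    then have "AE t in lebesgue. t \<notin> D"
      using assms(6) by (intro AE_not_in) auto
    with assms(8) show ?thesis
      unfolding supp_subset_def by eventually_elim (auto simp: support_on_def)
  next
    case False
    then consider "emeasure lebesgue S = 0" | "emeasure lebesgue D < \<infinity>" "emeasure lebesgue S < \<infinity>"
      using assms(10) by (auto simp: ennreal_mult_less_top)
    then have g0: "AE t in lborel. g w t = 0" for w
    proof cases
      case 1
      then have "AE x in lborel. fourier (g w) x = 0"
        using freq[of w] by (subst AE_iff_measurable[OF _ refl]) auto
      then show ?thesis by (rule AE_fourier_eq_0_imp_AE_eq_0[OF g_int])
    next
      case 2
      have "ennreal \<bar>- 1 / b\<bar> * emeasure lebesgue S < \<infinity>"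
        using 2(2) by (simp add: ennreal_mult_less_top)
      then show ?thesis
        using time[of w] freq[of w] 2(1) by (intro Benedicks g_int) (auto elim: le_less_trans)
    qed
    have "AE t in lborel. f' t = 0"
    proof (rule AE_mult_translates_eq_0)
      show "AE t in lborel. f' t * cnj (\<phi>' (t - w)) = 0" for w
        using g0[of w] by eventually_elim (use g_nonzero in blast)
      show "\<not> (AE t in lborel. cnj (\<phi>' t) = 0)"
      proof
        assume "AE t in lborel. cnj (\<phi>' t) = 0"
        with \<phi>\<phi>' have "AE t in lborel. \<phi> t = 0" by eventually_elim simp
        then show False using assms(4) AE_completion by blast
      qed
    qed measurable
    with ff' have "AE t in lborel. f t = 0" by eventually_elim simp
    then show ?thesis by (rule AE_completion)
  qed
qed

end
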